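(* Let $\Gamma \cup \{\varphi\} \subseteq \mathfrak{F}_{\{\land,\neg\}}$. Then $\Gamma \vdash_{\{\land,\neg\}} \varphi$ if and only if $\Gamma \vDash_{\mathbf{3}} \varphi$.
   Context: Let $\Pi$ be an infinite set of propositional letters. $\mathfrak{F}_{\{\land,\neg\}}$ is the set of formulas built from $\Pi$ using only the binary connective $\land$ and the unary connective $\neg$. Derivability $\vdash_{\{\land,\neg\}}$ is the smallest relation between sets of formulas of $\mathfrak{F}_{\{\land,\neg\}}$ and formulas of $\mathfrak{F}_{\{\land,\neg\}}$ satisfying: (R$_\in$) if $\varphi \in \Gamma$, then $\Gamma \vdash \varphi$; (R$_m$) if $\Gamma \vdash \varphi$, then $\Gamma, \psi \vdash \varphi$; (R$_t$) if $\Gamma \vdash \varphi$ and $\Delta, \varphi \vdash \psi$, then $\Gamma, \Delta \vdash \psi$; (R$_\land$) $\Gamma \vdash \varphi \land \psi$ iff $\Gamma \vdash \varphi$ and $\Gamma \vdash \psi$; (R$_{\neg I}$) if $\Gamma, \varphi \vdash \psi$ and $\Gamma, \varphi \vdash \neg\psi$, then $\Gamma \vdash \neg\varphi$; (R$_{\neg E}$) if $\Gamma \vdash \varphi$ and $\Gamma \vdash \neg\varphi$, then $\Gamma \vdash \psi$. $\mathbf{3}$ is the algebra $\langle \{0,\tfrac12,1\}; \land, \neg\rangle$ with $a \land b = \min\{a,b\}$, $\neg 0 = 1$ and $\neg\tfrac12 = \neg 1 = 0$, with set of designated values $D = \{1\}$. $\Gamma \vDash_{\mathbf{3}} \varphi$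 means: for every assignment $v : \Pi \to \{0,\tfrac12,1\}$, with unique homomorphic extension $\bar v : \mathfrak{F}_{\{\land,\neg\}} \to \{0,\tfrac12,1\}$, if $\bar v(\psi) = 1$ for all $\psi \in \Gamma$, then $\bar v(\varphi) = 1$. *)

theory Defs
  imports Main
begin

datatype 'p form = Var 'p | Conj "'p form" "'p form" (infixr "\<sqinter>" 70) | Neg "'p form" ("\<sim> _" [75] 75)

(* "Gamma, psi" is rendered as insert psi Gamma, "Gamma, Delta" as Gamma \<union> Delta; antecedents are
   arbitrary, possibly infinite, sets.  The two-way rule for conjunction is split into its
   introduction part and the two elimination parts. *)
inductive derives :: "'p form set \<Rightarrow> 'p form \<Rightarrow> bool" (infix "\<turnstile>" 50) where
  R_in: "\<phi> \<in> \<Gamma> \<Longrightarrow> \<Gamma> \<turnstile> \<phi>"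
| R_m: "\<Gamma> \<turnstile> \<phi> \<Longrightarrow> insert \<psi> \<Gamma> \<turnstile> \<phi>"
| R_t: "\<Gamma> \<turnstile> \<phi> \<Longrightarrow> insert \<phi> \<Delta> \<turnstile> \<psi> \<Longrightarrow> \<Gamma> \<union> \<Delta> \<turnstile> \<psi>"
| R_conjI: "\<Gamma> \<turnstile> \<phi> \<Longrightarrow> \<Gamma> \<turnstile> \<psi> \<Longrightarrow> \<Gamma> \<turnstile> \<phi> \<sqinter> \<psi>"
| R_conjE1: "\<Gamma> \<turnstile> \<phi> \<sqinter> \<psi> \<Longrightarrow> \<Gamma> \<turnstile> \<phi>"
| R_conjE2: "\<Gamma> \<turnstile> \<phi> \<sqinter> \<psi> \<Longrightarrow> \<Gamma> \<turnstile> \<psi>"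
| R_negI: "insert \<phi> \<Gamma> \<turnstile> \<psi> \<Longrightarrow> insert \<phi> \<Gamma> \<turnstile> \<sim> \<psi> \<Longrightarrow> \<Gamma> \<turnstile> \<sim> \<phi>"
| R_negE: "\<Gamma> \<turnstile> \<phi> \<Longrightarrow> \<Gamma> \<turnstile> \<sim> \<phi> \<Longrightarrow> \<Gamma> \<turnstile> \<psi>"

datatype three = Zero | Half | One

(* The chain Zero < Half < One. *)
instantiation three :: linorder
begin

definition less_eq_three :: "three \<Rightarrow> three \<Rightarrow> bool" where
  "a \<le> b \<longleftrightarrow> a = Zero \<or> a = b \<or> b = One"

definition less_three :: "three \<Rightarrow> three \<Rightarrow> bool" where
  "(a :: three) < b \<longleftrightarrow> a \<le> b \<and> \<not> b \<le> a"

instance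
proof
  fix a b c :: three
  show "a < b \<longleftrightarrow> a \<le> b \<and> \<not> b \<le> a"
    by (rule less_three_def)
  show "a \<le> a"
    by (simp add: less_eq_three_def)
  show "a \<le> c" if "a \<le> b" "b \<le> c"
    using that by (auto simp: less_eq_three_def)
  show "a = b" if "a \<le> b" "b \<le> a"
    using that by (auto simp: less_eq_three_def)
  show "a \<le> b \<or> b \<le> a"
    by (cases a; cases b) (auto simp: less_eq_three_def)
qed

end

fun neg3 :: "three \<Rightarrow> three" where
  "neg3 Zero = One"
| "neg3 Half = Zero"
| "neg3 One = Zero"

primrec eval3 :: "('p \<Rightarrow> three) \<Rightarrow> 'p form \<Rightarrow> three" where
  "eval3 v (Var p) = v p"
| "eval3 v (\<phi> \<sqinter> \<psi>) = min (eval3 v \<phi>) (eval3 v \<psi>)"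
| "eval3 v (\<sim> \<phi>) = neg3 (eval3 v \<phi>)"

definition entails3 :: "'p form set \<Rightarrow> 'p form \<Rightarrow> bool" (infix "\<Turnstile>\<^sub>3" 50) where
  "\<Gamma> \<Turnstile>\<^sub>3 \<phi> \<longleftrightarrow> (\<forall>v. (\<forall>\<psi>\<in>\<Gamma>. eval3 v \<psi> = One) \<longrightarrow> eval3 v \<phi> = One)"

end

theory Submission
  imports Defs
begin

text \<open>
  Soundness is only delicate for negation introduction, because an assumption of value
  \<open>Half\<close> is not designated and so semantic consequence says nothing about it directly.  The map
  that sends \<open>Half\<close> to \<open>One\<close> and fixes the other two values is an endomorphism of the algebra
  (lemma \<open>eval3_collapse\<close>).  A valuation that gives the discharged assumption a
  non-zero value therefore becomes one that designates it, and the assumption is refuted there.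

  Completeness rests on a division of labour between the values.  A set \<open>M\<close> that is maximal
  consistent (lemma \<open>consistent_extends_to_maximal\<close>) behaves like a classical model, so it can
  decide which formulas get a non-zero value; derivability from \<open>\<Gamma> \<subseteq> M\<close> then
  decides which letters in \<open>M\<close> are raised from \<open>Half\<close> to \<open>One\<close>.  Since a negation takes only the
  values \<open>Zero\<close> and \<open>One\<close>, and depends only on whether its argument is zero, everything
  derivable from \<open>\<Gamma>\<close> receives \<open>One\<close>.

  To refute an underivable \<open>\<phi>\<close> there are three cases.  An underivable letter has a value below
  \<open>One\<close> whatever \<open>M\<close> is; an underivable conjunction has an underivable conjunct; and if
  \<open>\<sim> \<psi>\<close> is underivable then \<open>\<Gamma>\<close> together with \<open>\<psi>\<close> is consistent, so \<open>M\<close> may be chosen to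
  contain \<open>\<psi>\<close>, which makes \<open>\<sim> \<psi>\<close> zero.
\<close>

section \<open>Soundness\<close>

lemma min_three_eq_One_iff: "min a b = One \<longleftrightarrow> a = One \<and> b = One"
  by (cases a; cases b) (simp_all add: min_def less_eq_three_def)

lemma min_three_eq_Zero_iff: "min a b = Zero \<longleftrightarrow> a = Zero \<or> b = Zero"
  by (cases a; cases b) (simp_all add: min_def less_eq_three_def)

lemma neg3_eq_One_iff: "neg3 a = One \<longleftrightarrow> a = Zero"
  by (cases a) simp_all

lemma neg3_eq_Zero_iff: "neg3 a = Zero \<longleftrightarrow> a \<noteq> Zero"
  by (cases a) simp_all

definition collapse :: "three \<Rightarrow> three" where
  "collapse a = (if a = Zero then Zero else One)"

lemma collapse_eq_One_iff: "collapse a = One \<longleftrightarrow> a \<noteq> Zero"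
  by (simp add: collapse_def)

lemma collapse_min: "collapse (min a b) = min (collapse a) (collapse b)"
  by (cases a; cases b) (simp_all add: collapse_def min_def less_eq_three_def)

lemma collapse_neg3: "collapse (neg3 a) = neg3 (collapse a)"
  by (cases a) (simp_all add: collapse_def)

lemma eval3_collapse: "eval3 (collapse \<circ> v) \<phi> = collapse (eval3 v \<phi>)"
  by (induction \<phi>) (simp_all add: collapse_min collapse_neg3)

text \<open>
  Premises of value \<open>One\<close> keep it under \<open>collapse\<close>, while any non-zero assumption acquires it.
  So a consequence with an extra assumption also governs valuations where that assumption
  is merely non-zero, at the price of a merely non-zero conclusion.
\<close>

lemma entails3_insert_nonzero:
  assumes "insert \<phi> \<Gamma> \<Turnstile>\<^sub>3 \<psi>"
    and "\<forall>\<chi>\<in>\<Gamma>. eval3 v \<chi> = One" and "eval3 v \<phi> \<noteq> Zero"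
  shows "eval3 v \<psi> \<noteq> Zero"
proof -
  have "\<forall>\<chi>\<in>insert \<phi> \<Gamma>. eval3 (collapse \<circ> v) \<chi> = One"
    using assms(2,3) by (simp add: eval3_collapse collapse_eq_One_iff)
  then have "eval3 (collapse \<circ> v) \<psi> = One"
    using assms(1) unfolding entails3_def by blast
  then show ?thesis
    by (simp add: eval3_collapse collapse_eq_One_iff)
qed

lemma soundness: "\<Gamma> \<turnstile> \<phi> \<Longrightarrow> \<Gamma> \<Turnstile>\<^sub>3 \<phi>"
proof (induction rule: derives.induct)
  case (R_negI \<phi> \<Gamma> \<psi>)
  show ?case
    unfolding entails3_def
  proof (intro allI impI)
    fix v
    assume \<Gamma>: "\<forall>\<chi>\<in>\<Gamma>. eval3 v \<chi> = One"
    have "eval3 v \<phi> = Zero"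
      using entails3_insert_nonzero[OF R_negI.IH(1) \<Gamma>] entails3_insert_nonzero[OF R_negI.IH(2) \<Gamma>]
      by (auto simp: neg3_eq_Zero_iff)
    then show "eval3 v (\<sim> \<phi>) = One"
      by simp
  qed
next
  case (R_negE \<Gamma> \<phi> \<psi>)
  then show ?case
    by (force simp: entails3_def neg3_eq_One_iff)
qed (auto simp: entails3_def min_three_eq_One_iff)

section \<open>Derivability and consistency\<close>

text \<open>
  Weakening by an arbitrary, possibly infinite, set: cut with the trivial derivation of the
  conclusion from itself.
\<close>

lemma weakening:
  assumes "\<Gamma> \<turnstile> \<phi>" and "\<Gamma> \<subseteq> \<Delta>"
  shows "\<Delta> \<turnstile> \<phi>"
proof -
  have "\<Gamma> \<union> \<Delta> \<turnstile> \<phi>"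
    by (rule R_t[OF assms(1)]) (simp add: R_in)
  then show ?thesis
    using assms(2) by (simp add: Un_absorb1)
qed

lemma cut: "\<Gamma> \<turnstile> \<phi> \<Longrightarrow> insert \<phi> \<Gamma> \<turnstile> \<psi> \<Longrightarrow> \<Gamma> \<turnstile> \<psi>"
  using R_t[of \<Gamma> \<phi> \<Gamma> \<psi>] by simp

text \<open>
  Antecedents may be infinite, but every rule uses only finitely many premises, so each
  derivation has a finite core.
\<close>

lemma derives_finitary: "\<Gamma> \<turnstile> \<phi> \<Longrightarrow> \<exists>F. finite F \<and> F \<subseteq> \<Gamma> \<and> F \<turnstile> \<phi>"
proof (induction rule: derives.induct)
  case (R_in \<phi> \<Gamma>)
  then show ?case
    by (intro exI[of _ "{\<phi>}"]) (simp add: derives.R_in)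
next
  case (R_m \<Gamma> \<phi> \<psi>)
  then show ?case
    by blast
next
  case (R_t \<Gamma> \<phi> \<Delta> \<psi>)
  then obtain F G where F: "finite F" "F \<subseteq> \<Gamma>" "F \<turnstile> \<phi>"
    and G: "finite G" "G \<subseteq> insert \<phi> \<Delta>" "G \<turnstile> \<psi>"
    by blast
  have "insert \<phi> (G - {\<phi>}) \<turnstile> \<psi>"
    using G(3) by (rule weakening) blast
  then have "F \<union> (G - {\<phi>}) \<turnstile> \<psi>"
    by (rule derives.R_t[OF F(3)])
  then show ?case
    using F G by (intro exI[of _ "F \<union> (G - {\<phi>})"]) auto
next
  case (R_conjI \<Gamma> \<phi> \<psi>)
  then obtain F G where F: "finite F" "F \<subseteq> \<Gamma>" "F \<turnstile> \<phi>"
    and G: "finite G" "G \<subseteq> \<Gamma>" "G \<turnstile> \<psi>"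
    by blast
  have "F \<union> G \<turnstile> \<phi> \<sqinter> \<psi>"
    using F(3) G(3) by (blast intro: derives.R_conjI weakening)
  then show ?case
    using F G by (intro exI[of _ "F \<union> G"]) auto
next
  case (R_conjE1 \<Gamma> \<phi> \<psi>)
  then show ?case
    by (blast intro: derives.R_conjE1)
next
  case (R_conjE2 \<Gamma> \<phi> \<psi>)
  then show ?case
    by (blast intro: derives.R_conjE2)
next
  case (R_negI \<phi> \<Gamma> \<psi>)
  then obtain F G where F: "finite F" "F \<subseteq> insert \<phi> \<Gamma>" "F \<turnstile> \<psi>"
    and G: "finite G" "G \<subseteq> insert \<phi> \<Gamma>" "G \<turnstile> \<sim> \<psi>"
    by blast
  let ?H = "(F \<union> G) - {\<phi>}"
  have "insert \<phi> ?H \<turnstile> \<psi>"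
    using F(3) by (rule weakening) blast
  moreover have "insert \<phi> ?H \<turnstile> \<sim> \<psi>"
    using G(3) by (rule weakening) blast
  ultimately have "?H \<turnstile> \<sim> \<phi>"
    by (rule derives.R_negI)
  then show ?case
    using F G by (intro exI[of _ ?H]) auto
next
  case (R_negE \<Gamma> \<phi> \<psi>)
  then obtain F G where F: "finite F" "F \<subseteq> \<Gamma>" "F \<turnstile> \<phi>"
    and G: "finite G" "G \<subseteq> \<Gamma>" "G \<turnstile> \<sim> \<phi>"
    by blast
  have "F \<union> G \<turnstile> \<psi>"
    using F(3) G(3) by (blast intro: derives.R_negE weakening)
  then show ?case
    using F G by (intro exI[of _ "F \<union> G"]) auto
qed

definition consistent :: "'p form set \<Rightarrow> bool" where
  "consistent \<Gamma> \<longleftrightarrow> (\<exists>\<phi>. \<not> \<Gamma> \<turnstile> \<phi>)"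

lemma inconsistent_insert_imp_derives_Neg:
  "\<not> consistent (insert \<phi> \<Gamma>) \<Longrightarrow> \<Gamma> \<turnstile> \<sim> \<phi>"
  by (auto simp: consistent_def intro: R_negI)

lemma consistent_not_derives_both:
  "consistent \<Gamma> \<Longrightarrow> \<Gamma> \<turnstile> \<phi> \<Longrightarrow> \<not> \<Gamma> \<turnstile> \<sim> \<phi>"
  by (auto simp: consistent_def intro: R_negE)

definition maximal_consistent :: "'p form set \<Rightarrow> bool" where
  "maximal_consistent M \<longleftrightarrow> consistent M \<and> (\<forall>N. consistent N \<longrightarrow> M \<subseteq> N \<longrightarrow> N = M)"

text \<open>
  Inconsistency of the union of a chain would show as a derivable contradiction
  \<open>\<chi>\<close>, \<open>\<sim> \<chi>\<close>; its finite core lies in a single member of the chain, so Zorn's lemma applies.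
\<close>

lemma consistent_extends_to_maximal:
  assumes "consistent \<Gamma>"
  obtains M where "\<Gamma> \<subseteq> M" and "maximal_consistent M"
proof -
  let ?A = "{N. consistent N \<and> \<Gamma> \<subseteq> N}"
  have "\<Union>\<C> \<in> ?A" if ne: "\<C> \<noteq> {}" and chain: "subset.chain ?A \<C>" for \<C>
  proof -
    have sub: "\<C> \<subseteq> ?A"
      using chain by (simp add: subset.chain_def)
    have "consistent (\<Union>\<C>)"
    proof (rule ccontr)
      fix \<chi> :: "'a form"
      assume "\<not> consistent (\<Union>\<C>)"
      then have "\<Union>\<C> \<turnstile> \<chi>" "\<Union>\<C> \<turnstile> \<sim> \<chi>"
        by (simp_all add: consistent_def)
      then obtain F G where F: "finite F" "F \<subseteq> \<Union>\<C>" "F \<turnstile> \<chi>"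
        and G: "finite G" "G \<subseteq> \<Union>\<C>" "G \<turnstile> \<sim> \<chi>"
        by (meson derives_finitary)
      obtain N where N: "N \<in> \<C>" "F \<union> G \<subseteq> N"
        using finite_subset_Union_chain[of "F \<union> G" \<C> ?A] F G ne chain by auto
      have "N \<turnstile> \<chi>" "N \<turnstile> \<sim> \<chi>"
        using F(3) G(3) N(2) by (auto intro: weakening)
      moreover have "consistent N"
        using N(1) sub by blast
      ultimately show False
        using consistent_not_derives_both by blast
    qed
    moreover have "\<Gamma> \<subseteq> \<Union>\<C>"
      using ne sub by blast
    ultimately show ?thesis
      by simp
  qed
  moreover have "?A \<noteq> {}"
    using assms by blast
  ultimately obtain M where M: "M \<in> ?A" and max: "\<forall>N\<in>?A. M \<subseteq> N \<longrightarrow> N = M"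
    using subset_Zorn_nonempty[of ?A] by auto
  show thesis
  proof (rule that)
    show "\<Gamma> \<subseteq> M"
      using M by simp
    then show "maximal_consistent M"
      using M max unfolding maximal_consistent_def by blast
  qed
qed

lemma maximal_consistent_derives_iff:
  assumes "maximal_consistent M"
  shows "M \<turnstile> \<phi> \<longleftrightarrow> \<phi> \<in> M"
proof
  assume "M \<turnstile> \<phi>"
  then have "consistent (insert \<phi> M)"
    using assms unfolding maximal_consistent_def consistent_def by (meson cut)
  then show "\<phi> \<in> M"
    using assms unfolding maximal_consistent_def by blast
qed (rule R_in)

lemma maximal_consistent_Conj_iff:
  assumes "maximal_consistent M"
  shows "\<phi> \<sqinter> \<psi> \<in> M \<longleftrightarrow> \<phi> \<in> M \<and> \<psi> \<in> M"
  unfolding maximal_consistent_derives_iff[OF assms, symmetric]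
  by (blast intro: R_conjI R_conjE1 R_conjE2)

lemma maximal_consistent_Neg_iff:
  assumes "maximal_consistent M"
  shows "\<sim> \<phi> \<in> M \<longleftrightarrow> \<phi> \<notin> M"
proof
  assume "\<sim> \<phi> \<in> M"
  then show "\<phi> \<notin> M"
    using assms consistent_not_derives_both R_in unfolding maximal_consistent_def by metis
next
  assume "\<phi> \<notin> M"
  then have "\<not> consistent (insert \<phi> M)"
    using assms unfolding maximal_consistent_def by blast
  then show "\<sim> \<phi> \<in> M"
    using maximal_consistent_derives_iff[OF assms] inconsistent_insert_imp_derives_Neg by blast
qed

section \<open>Completeness\<close>

text \<open>
  The valuation describes a two-world Kripke model with \<open>\<Gamma>\<close> below \<open>M\<close>: letters derivable
  from \<open>\<Gamma>\<close> hold at both worlds, and those in \<open>M\<close> hold at the upper one.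
\<close>

definition canonical_valuation :: "'p form set \<Rightarrow> 'p form set \<Rightarrow> 'p \<Rightarrow> three" where
  "canonical_valuation \<Gamma> M p =
    (if \<Gamma> \<turnstile> Var p then One else if Var p \<in> M then Half else Zero)"

lemma eval3_canonical_valuation_nonzero_iff:
  assumes "maximal_consistent M" and "\<Gamma> \<subseteq> M"
  shows "eval3 (canonical_valuation \<Gamma> M) \<phi> \<noteq> Zero \<longleftrightarrow> \<phi> \<in> M"
proof (induction \<phi>)
  case (Var p)
  have "Var p \<in> M" if "\<Gamma> \<turnstile> Var p"
    using weakening[OF that assms(2)] maximal_consistent_derives_iff[OF assms(1)] by blast
  then show ?case
    by (simp add: canonical_valuation_def)
next
  case (Conj \<phi> \<psi>)
  then show ?case
    using maximal_consistent_Conj_iff[OF assms(1)] by (simp add: min_three_eq_Zero_iff)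
next
  case (Neg \<phi>)
  then show ?case
    using maximal_consistent_Neg_iff[OF assms(1)] by (simp add: neg3_eq_Zero_iff)
qed

text \<open>
  The negation case needs no induction hypothesis: if \<open>\<Gamma>\<close> derives \<open>\<sim> \<psi>\<close> then \<open>M\<close> omits \<open>\<psi>\<close>,
  so \<open>\<psi>\<close> is zero.  For the same reason the converse can fail: \<open>M\<close> may omit \<open>\<psi>\<close> although \<open>\<Gamma>\<close>
  does not derive \<open>\<sim> \<psi>\<close>, so \<open>M\<close> has to be adapted to the formula to be refuted.
\<close>

lemma eval3_canonical_valuation_derivable:
  assumes "maximal_consistent M" and "\<Gamma> \<subseteq> M" and "\<Gamma> \<turnstile> \<phi>"
  shows "eval3 (canonical_valuation \<Gamma> M) \<phi> = One"
  using assms(3)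
proof (induction \<phi> rule: form.induct)
  case (Var p)
  then show ?case
    by (simp add: canonical_valuation_def)
next
  case (Conj \<phi> \<psi>)
  then show ?case
    by (auto simp: min_three_eq_One_iff intro: R_conjE1 R_conjE2)
next
  case (Neg \<phi>)
  have "\<phi> \<notin> M"
    using weakening[OF Neg.prems assms(2)] maximal_consistent_derives_iff[OF assms(1)]
      maximal_consistent_Neg_iff[OF assms(1)] by blast
  then show ?case
    using eval3_canonical_valuation_nonzero_iff[OF assms(1,2), of \<phi>] by (simp add: neg3_eq_One_iff)
qed

lemma refuting_canonical_valuation:
  assumes "\<not> \<Gamma> \<turnstile> \<phi>"
  shows "\<exists>M. maximal_consistent M \<and> \<Gamma> \<subseteq> M \<and> eval3 (canonical_valuation \<Gamma> M) \<phi> \<noteq> One"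
  using assms
proof (induction \<phi>)
  case (Var p)
  then have "consistent \<Gamma>"
    by (auto simp: consistent_def)
  then obtain M where "\<Gamma> \<subseteq> M" "maximal_consistent M"
    by (rule consistent_extends_to_maximal)
  moreover have "eval3 (canonical_valuation \<Gamma> M) (Var p) \<noteq> One"
    using Var by (simp add: canonical_valuation_def)
  ultimately show ?case
    by blast
next
  case (Conj \<phi> \<psi>)
  then have "\<not> \<Gamma> \<turnstile> \<phi> \<or> \<not> \<Gamma> \<turnstile> \<psi>"
    by (blast intro: R_conjI)
  then show ?case
    using Conj.IH by (auto simp: min_three_eq_One_iff)
next
  case (Neg \<psi>)
  then have "consistent (insert \<psi> \<Gamma>)"
    using inconsistent_insert_imp_derives_Neg by blast
  then obtain M where M: "insert \<psi> \<Gamma> \<subseteq> M" "maximal_consistent M"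
    by (rule consistent_extends_to_maximal)
  then have "eval3 (canonical_valuation \<Gamma> M) \<psi> \<noteq> Zero"
    using eval3_canonical_valuation_nonzero_iff[of M \<Gamma> \<psi>] by simp
  then have "eval3 (canonical_valuation \<Gamma> M) (\<sim> \<psi>) \<noteq> One"
    by (simp add: neg3_eq_One_iff)
  then show ?case
    using M by blast
qed

lemma completeness:
  assumes "\<Gamma> \<Turnstile>\<^sub>3 \<phi>"
  shows "\<Gamma> \<turnstile> \<phi>"
proof (rule ccontr)
  assume "\<not> \<Gamma> \<turnstile> \<phi>"
  then obtain M where M: "maximal_consistent M" "\<Gamma> \<subseteq> M"
    and refuted: "eval3 (canonical_valuation \<Gamma> M) \<phi> \<noteq> One"
    using refuting_canonical_valuation by blast
  have "\<forall>\<psi>\<in>\<Gamma>. eval3 (canonical_valuation \<Gamma> M) \<psi> = One"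
    using eval3_canonical_valuation_derivable[OF M] by (blast intro: R_in)
  then show False
    using assms refuted unfolding entails3_def by blast
qed

theorem proposition7:
  fixes \<Gamma> :: "'p form set" and \<phi> :: "'p form"
  assumes "infinite (UNIV :: 'p set)"
  shows "\<Gamma> \<turnstile> \<phi> \<longleftrightarrow> \<Gamma> \<Turnstile>\<^sub>3 \<phi>"
  using soundness completeness by blast

end
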